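(* Let $C$ be a positive integer. If $H$ is an oriented graph on $N\ge21C-12$ vertices with $\delta^0(H)\ge\frac N3-C+1$, then for every ordered pair $(x,y)$ of distinct vertices of $H$ there is a directed path from $x$ to $y$ in $H$ of length $3$, $4$, or $5$.
   Context: An oriented graph is an orientation of a (finite) simple graph: no loops, and at most one arc on each unordered pair of vertices. $\delta^0(H)=\min_{v}\min\{d^+(v),d^-(v)\}$ is the minimum semidegree. Paths are directed and simple (no repeated vertices), and the length is the number of arcs. *)

theory Defs
  imports Complex_Main "Graph_Theory.Arc_Walk"
begin

(* digraph already excludes loops and parallel arcs; no_2cycle then leaves at most one arc
   on each unordered pair of vertices. *)
locale oriented_graph = digraph +
  assumes no_2cycle: "u \<rightarrow>\<^bsub>G\<^esub> v \<Longrightarrow> \<not> v \<rightarrow>\<^bsub>G\<^esub> u"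

(* Unspecified (Min of the empty set) for the null graph. *)
definition min_semidegree :: "('a, 'b) pre_digraph \<Rightarrow> nat" where
  "min_semidegree G = Min ((\<lambda>v. min (out_degree G v) (in_degree G v)) ` verts G)"

end

theory Submission
  imports Defs
begin

text \<open>
  Write $N = |V(H)|$ and $d = \delta^0(H)$. The two numerical hypotheses give $7d \ge 2N + 3$ and
  $d \ge 3$, which is enough. Suppose that there is no path of length 3, 4 or 5 and put
  $X = N^+(x) - y$, $Y = N^-(y) - x$, $I = X \cap Y$. Then no arc leads from $X \cup N^+(X)$ to
  $Y \cup N^-(Y)$, apart from arcs that close a triangle at a vertex of $I$.

  If $|I| \ge d - 1$, fix $u \in I$ and let $P = N^+(u)$, $Q = N^-(Y - u)$. The sets $I, P, Q$ are
  disjoint, of size at least $d - 1$, and $Q$ receives no arc from $I \cup P \cup \{x\}$. Some vertex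
  of $Q$ has at most $(|Q| - 1)/2$ in-neighbours in $Q$, so few vertices remain to supply its
  in-degree.

  If $|I| \le d - 2$, use instead $S = X' \cup N^+(X')$ and $T = Y' \cup N^-(Y)$ with $X' = X - Y$ and
  $Y' = Y - X$. A vertex of small out-degree inside $X'$ shows that $S$ is large, and dually $T$ is
  large. In-neighbours of $Y'$ stay inside $T$, and in-neighbours of $T - Y'$ stay
  inside $T$ together with the few vertices outside $S \cup T \cup I \cup \{x\}$. Counting the arcs into
  $T$ gives a contradiction.
\<close>

section \<open>Arc counts in oriented graphs\<close>

lemma asym_arc_count:
  fixes E :: "'a \<Rightarrow> 'a \<Rightarrow> bool"
  assumes "finite T" and asym: "\<And>u v. E u v \<Longrightarrow> \<not> E v u"
  shows "2 * (\<Sum>v\<in>T. card {u \<in> T. E u v}) + card T \<le> card T * card T"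
proof -
  have card_sum: "card {u \<in> T. F u} = (\<Sum>u\<in>T. if F u then 1 else 0)" for F
    using \<open>finite T\<close> by (simp flip: sum.inter_filter)
  have swap: "(\<Sum>v\<in>T. card {u \<in> T. E u v}) = (\<Sum>v\<in>T. card {u \<in> T. E v u})"
    unfolding card_sum by (rule sum.swap)
  have le: "card {u \<in> T. E u v} + card {u \<in> T. E v u} + 1 \<le> card T" if "v \<in> T" for v
  proof -
    have "card {u \<in> T. E u v} + card {u \<in> T. E v u} = card ({u \<in> T. E u v} \<union> {u \<in> T. E v u})"
      using \<open>finite T\<close> asym by (subst card_Un_disjoint) auto
    also have "\<dots> \<le> card (T - {v})"
      using \<open>finite T\<close> asym by (intro card_mono) auto
    also have "\<dots> + 1 = card T"
      using \<open>finite T\<close> that card_Suc_Diff1 by fastforce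
    finally show ?thesis by simp
  qed
  have "2 * (\<Sum>v\<in>T. card {u \<in> T. E u v}) + card T
      = (\<Sum>v\<in>T. card {u \<in> T. E u v} + card {u \<in> T. E v u} + 1)"
    using swap by (simp only: sum.distrib mult_2) simp
  also have "\<dots> \<le> (\<Sum>v\<in>T. card T)"
    using le by (intro sum_mono) auto
  finally show ?thesis by simp
qed

text \<open>Averaging over \<open>asym_arc_count\<close>. Passing the reversed relation gives a
  vertex of small out-degree.\<close>

lemma asym_small_degree:
  fixes E :: "'a \<Rightarrow> 'a \<Rightarrow> bool"
  assumes "finite T" "T \<noteq> {}" "\<And>u v. E u v \<Longrightarrow> \<not> E v u"
  obtains v where "v \<in> T" "2 * card {u \<in> T. E u v} + 1 \<le> card T"
proof -
  have "\<exists>v\<in>T. 2 * card {u \<in> T. E u v} + 1 \<le> card T"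
  proof (rule ccontr)
    assume "\<not> ?thesis"
    then have "(\<Sum>v\<in>T. card T) < (\<Sum>v\<in>T. 2 * card {u \<in> T. E u v} + 1)"
      using assms(1,2) by (intro sum_strict_mono) auto
    also have "\<dots> = 2 * (\<Sum>v\<in>T. card {u \<in> T. E u v}) + card T"
      by (simp only: sum.distrib sum_distrib_left) simp
    finally show False
      using asym_arc_count[of T E] assms by simp
  qed
  then show ?thesis using that by blast
qed

text \<open>Sum the in-degrees over \<open>T\<close>: arcs from within \<open>T\<close> are bounded
  by \<open>asym_arc_count\<close>, and all others run from \<open>R\<close> to \<open>Q\<close>, so
  there are at most \<open>card Q * card R\<close> of them.\<close>

lemma in_degree_count:
  fixes E :: "'a \<Rightarrow> 'a \<Rightarrow> bool"
  assumes "finite T" "finite R" "Q \<subseteq> T" and asym: "\<And>u v. E u v \<Longrightarrow> \<not> E v u"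
    and deg: "\<And>v. v \<in> T \<Longrightarrow> d \<le> card {u. E u v}"
    and inside: "\<And>u v. v \<in> T - Q \<Longrightarrow> E u v \<Longrightarrow> u \<in> T"
    and outside: "\<And>u v. v \<in> Q \<Longrightarrow> E u v \<Longrightarrow> u \<in> T \<union> R"
  shows "2 * card T * d + card T \<le> card T * card T + 2 * card Q * card R"
proof -
  have "card T * d = (\<Sum>v\<in>T. d)" by simp
  also have "\<dots> \<le> (\<Sum>v\<in>T. card {u \<in> T. E u v} + (if v \<in> Q then card R else 0))"
  proof (rule sum_mono)
    fix v assume v: "v \<in> T"
    show "d \<le> card {u \<in> T. E u v} + (if v \<in> Q then card R else 0)"
    proof (cases "v \<in> Q")
      case True
      have "{u. E u v} \<subseteq> {u \<in> T. E u v} \<union> R" using outside True by blast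
      then have "card {u. E u v} \<le> card ({u \<in> T. E u v} \<union> R)"
        using assms(1,2) by (intro card_mono) auto
      also have "\<dots> \<le> card {u \<in> T. E u v} + card R" by (rule card_Un_le)
      finally show ?thesis using deg[OF v] True by simp
    next
      case False
      then have "{u. E u v} = {u \<in> T. E u v}" using inside v by blast
      then show ?thesis using deg[OF v] False by simp
    qed
  qed
  also have "\<dots> = (\<Sum>v\<in>T. card {u \<in> T. E u v}) + card Q * card R"
    using assms(1,3) by (simp add: sum.distrib sum.If_cases Int_absorb1)
  finally show ?thesis
    using asym_arc_count[of T E] assms(1) asym by simp
qed

text \<open>The closing arithmetic of \<open>small_intersection\<close>: t is the size of
  \<open>T\<close>, and the two factors of the product bound the size of \<open>Q\<close> and twice
  the size of \<open>R\<close>.\<close>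

lemma degree_inequality_contradiction:
  fixes t d m :: int
  assumes "2 * d + m + 1 \<le> 2 * t" "1 \<le> m" "m \<le> d - 1"
    and le: "2 * t * d + t \<le> t * t + (t - m) * (3 * d + m - 4 - 2 * t)"
  shows False
proof -
  \<comment> \<open>completing the square in \<^term>\<open>2 * t\<close>\<close>
  define z where "z = 2 * t - (d + 3 * m - 5)"
  have sq: "z * z \<le> (d - m) * (d - 5 * m) - 10 * d - 14 * m + 25"
    using le unfolding z_def by (simp add: algebra_simps)
  show False
  \<comment> \<open>If d is at most 5m, the right side of \<open>sq\<close> is negative. Otherwise
    the lower bound on t forces z to be so large that its square exceeds that side.\<close>
  proof (cases "d \<le> 5 * m")
    case True
    then have "(d - m) * (d - 5 * m) \<le> 0"
      using assms by (intro mult_nonneg_nonpos) auto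
    then show False using sq assms zero_le_square[of z] by linarith
  next
    case False
    then have "d - 2 * m + 6 \<le> z" "0 \<le> d - 2 * m + 6"
      using assms unfolding z_def by auto
    then have "(d - 2 * m + 6) * (d - 2 * m + 6) \<le> z * z"
      by (intro mult_mono) auto
    then have "0 \<le> m * m - 2 * (d * m) - 22 * d + 10 * m - 11"
      using sq by (simp add: algebra_simps)
    moreover have "m * m \<le> d * m"
      using assms by (intro mult_right_mono) auto
    moreover have "0 \<le> d * m" using assms by simp
    ultimately show False using assms by linarith
  qed
qed

section \<open>Neighbourhoods of a pair without short paths\<close>

locale no_short_path =
  fixes V :: "'a set" and E :: "'a \<Rightarrow> 'a \<Rightarrow> bool" and d :: nat and x y :: 'a
  assumes finite_V: "finite V"
    and E_V: "E u v \<Longrightarrow> u \<in> V \<and> v \<in> V"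
    and asym: "E u v \<Longrightarrow> \<not> E v u"
    and out_deg: "v \<in> V \<Longrightarrow> d \<le> card {u. E v u}"
    and in_deg: "v \<in> V \<Longrightarrow> d \<le> card {u. E u v}"
    and x_V: "x \<in> V" and y_V: "y \<in> V" and x_neq_y: "x \<noteq> y"
    and no3: "E x a \<Longrightarrow> E a b \<Longrightarrow> E b y \<Longrightarrow> \<not> distinct [x, a, b, y]"
    and no4: "E x a \<Longrightarrow> E a b \<Longrightarrow> E b c \<Longrightarrow> E c y \<Longrightarrow> \<not> distinct [x, a, b, c, y]"
    and no5: "E x a \<Longrightarrow> E a b \<Longrightarrow> E b c \<Longrightarrow> E c e \<Longrightarrow> E e y \<Longrightarrow> \<not> distinct [x, a, b, c, e, y]"
begin

text \<open>Removing \<open>x\<close> and \<open>y\<close> everywhere means that only coincidences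
  among interior vertices can spoil a path assembled from these sets.\<close>

definition X where "X = {v. E x v \<and> v \<noteq> y}"
definition Y where "Y = {v. E v y \<and> v \<noteq> x}"
definition outs where "outs A = {v. (\<exists>u\<in>A. E u v) \<and> v \<noteq> x \<and> v \<noteq> y}"
definition ins where "ins A = {v. (\<exists>u\<in>A. E v u) \<and> v \<noteq> x \<and> v \<noteq> y}"

lemma irrefl: "\<not> E v v"
  using asym by blast

lemma X_Y_no_arc:
  assumes "u \<in> X" "v \<in> Y"
  shows "\<not> E u v"
proof
  assume "E u v"
  moreover from this have "u \<noteq> v" using irrefl by blast
  ultimately show False
    using no3[of u v] assms irrefl[of x] irrefl[of y] x_neq_y unfolding X_def Y_def by auto
qed

text \<open>A common vertex w gives the path x, u, w, v, y of length 4; u = v is impossible because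
  it would create a 2-cycle with w.\<close>

lemma outs_ins_disjoint: "outs X \<inter> ins Y = {}"
proof (rule ccontr)
  assume "outs X \<inter> ins Y \<noteq> {}"
  then obtain u w v where "u \<in> X" "E u w" "w \<noteq> x" "w \<noteq> y" "E w v" "v \<in> Y"
    unfolding outs_def ins_def by blast
  moreover from this have "u \<noteq> w" "w \<noteq> v" "u \<noteq> v" using irrefl asym by blast+
  ultimately show False
    using no4[of u w v] irrefl x_neq_y unfolding X_def Y_def by auto
qed

text \<open>The arc would complete a path x, u, p, q, v, y. Here u = v would only close a triangle,
  which is allowed, so \<open>A\<close> and \<open>B\<close> must be disjoint.\<close>

lemma outs_ins_no_arc:
  assumes "A \<subseteq> X" "B \<subseteq> Y" "A \<inter> B = {}" "p \<in> outs A" "q \<in> ins B"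
  shows "\<not> E p q"
proof
  assume pq: "E p q"
  obtain u v where uv: "u \<in> A" "E u p" "v \<in> B" "E q v"
    using assms(4,5) unfolding outs_def ins_def by blast
  then have "u \<noteq> p" "u \<noteq> q" "u \<noteq> v" "p \<noteq> q" "p \<noteq> v" "q \<noteq> v"
    using pq assms(3) irrefl asym by blast+
  moreover have "p \<noteq> x" "p \<noteq> y" "q \<noteq> x" "q \<noteq> y"
    using assms(4,5) unfolding outs_def ins_def by auto
  moreover have "E x u" "u \<noteq> x" "u \<noteq> y" "E v y" "v \<noteq> x" "v \<noteq> y"
    using uv assms(1,2) irrefl unfolding X_def Y_def by auto
  ultimately show False
    using no5[of u p q v] uv pq x_neq_y by auto
qed

lemma X_V: "X \<subseteq> V" and Y_V: "Y \<subseteq> V" and outs_V: "outs A \<subseteq> V" and ins_V: "ins A \<subseteq> V"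
  unfolding X_def Y_def outs_def ins_def by (auto dest: E_V)

lemma finite_sets [simp]: "finite X" "finite Y" "finite (outs A)" "finite (ins A)"
  by (rule finite_subset[OF _ finite_V], rule X_V Y_V outs_V ins_V)+

lemma not_x_y: "x \<notin> X" "y \<notin> X" "x \<notin> Y" "y \<notin> Y" "x \<notin> outs A" "y \<notin> outs A" "x \<notin> ins A" "y \<notin> ins A"
  unfolding X_def Y_def outs_def ins_def by (auto simp: irrefl)

lemma finite_nbrs: "finite {u. E u v}" "finite {u. E v u}"
  by (rule finite_subset[OF _ finite_V], use E_V in blast)+

lemma card_X: "d \<le> card X + 1"
proof -
  have "{v. E x v} \<subseteq> insert y X" unfolding X_def by blast
  then have "card {v. E x v} \<le> card (insert y X)" by (intro card_mono) auto
  then show ?thesis using out_deg[OF x_V] by (simp add: card_insert_if split: if_splits)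
qed

lemma card_Y: "d \<le> card Y + 1"
proof -
  have "{v. E v y} \<subseteq> insert x Y" unfolding Y_def by blast
  then have "card {v. E v y} \<le> card (insert x Y)" by (intro card_mono) auto
  then show ?thesis using in_deg[OF y_V] by (simp add: card_insert_if split: if_splits)
qed

text \<open>Only one neighbour can be lost: the arc from \<open>x\<close> to \<open>u\<close>
  excludes the reverse arc, so \<open>outs\<close> drops at most \<open>y\<close>.\<close>

lemma card_outs:
  assumes "u \<in> A" "A \<subseteq> X"
  shows "d \<le> card (outs A) + 1"
proof -
  have "{v. E u v} \<subseteq> insert y (outs A)"
    using assms asym unfolding outs_def X_def by auto
  then have "card {v. E u v} \<le> card (insert y (outs A))"
    by (intro card_mono) auto
  moreover have "u \<in> V" using assms X_V by blast
  ultimately show ?thesis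
    using out_deg[of u] by (simp add: card_insert_if split: if_splits)
qed

lemma card_ins:
  assumes "v \<in> B" "B \<subseteq> Y"
  shows "d \<le> card (ins B) + 1"
proof -
  have "{u. E u v} \<subseteq> insert x (ins B)"
    using assms asym unfolding ins_def Y_def by auto
  then have "card {u. E u v} \<le> card (insert x (ins B))"
    by (intro card_mono) auto
  moreover have "v \<in> V" using assms Y_V by blast
  ultimately show ?thesis
    using in_deg[of v] by (simp add: card_insert_if split: if_splits)
qed

text \<open>An in-neighbour in \<open>X\<close> would put \<open>v\<close> into
  \<open>outs X\<close>; the in-neighbour \<open>x\<close> would put \<open>v\<close> into
  \<open>X\<close>, although \<open>v\<close> has an arc to \<open>Y\<close>.\<close>

lemma ins_in_nbrs:
  assumes "v \<in> ins Y" "E u v"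
  shows "u \<notin> X" "u \<noteq> x"
proof -
  show "u \<notin> X"
    using assms outs_ins_disjoint not_x_y unfolding outs_def by blast
  show "u \<noteq> x"
    using assms X_Y_no_arc not_x_y unfolding X_def ins_def by blast
qed

text \<open>A vertex with at most half of the rest of \<open>X - Y\<close> as out-neighbours has its
  remaining out-neighbours outside this set. None of its d out-neighbours is lost, since a vertex
  outside \<open>Y\<close> has no arc to \<open>y\<close>.\<close>

lemma card_X_outs:
  assumes "X - Y \<noteq> {}"
  shows "2 * d + card (X - Y) + 1 \<le> 2 * card ((X - Y) \<union> outs (X - Y))"
proof -
  let ?X = "X - Y"
  obtain u where u: "u \<in> ?X" and deg: "2 * card {v \<in> ?X. E u v} + 1 \<le> card ?X"
    using asym_small_degree[of ?X "\<lambda>v u. E u v"] assms asym by auto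
  have "{v. E u v} \<subseteq> outs ?X"
    using u asym unfolding outs_def X_def Y_def by blast
  then have "?X \<union> ({v. E u v} - {v \<in> ?X. E u v}) \<subseteq> ?X \<union> outs ?X" by blast
  then have "card (?X \<union> ({v. E u v} - {v \<in> ?X. E u v})) \<le> card (?X \<union> outs ?X)"
    by (intro card_mono) auto
  moreover have "card (?X \<union> ({v. E u v} - {v \<in> ?X. E u v}))
      = card ?X + card ({v. E u v} - {v \<in> ?X. E u v})"
    using finite_nbrs by (intro card_Un_disjoint) auto
  moreover have "card ({v. E u v} - {v \<in> ?X. E u v}) = card {v. E u v} - card {v \<in> ?X. E u v}"
    by (intro card_Diff_subset) auto
  moreover have "d \<le> card {v. E u v}" using out_deg u X_V by blast
  ultimately show ?thesis using deg by linarith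
qed

text \<open>\<open>u\<close> is not \<open>x\<close> because \<open>v\<close> is not in
  \<open>X\<close>, and not \<open>y\<close> because \<open>v\<close> has an arc to
  \<open>y\<close>.\<close>

lemma Y_in_nbrs:
  assumes "v \<in> Y - X" "E u v"
  shows "u \<in> ins Y"
  using assms asym unfolding ins_def X_def Y_def by blast

lemma card_Y_ins:
  assumes "Y - X \<noteq> {}"
  shows "2 * d + card (Y - X) + 1 \<le> 2 * card ((Y - X) \<union> ins Y)"
proof -
  let ?Y = "Y - X"
  obtain v where v: "v \<in> ?Y" and deg: "2 * card {u \<in> ?Y. E u v} + 1 \<le> card ?Y"
    using asym_small_degree[of ?Y E] assms asym by auto
  have "?Y \<union> ({u. E u v} - {u \<in> ?Y. E u v}) \<subseteq> ?Y \<union> ins Y"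
    using v Y_in_nbrs by blast
  then have "card (?Y \<union> ({u. E u v} - {u \<in> ?Y. E u v})) \<le> card (?Y \<union> ins Y)"
    by (intro card_mono) auto
  moreover have "card (?Y \<union> ({u. E u v} - {u \<in> ?Y. E u v}))
      = card ?Y + card ({u. E u v} - {u \<in> ?Y. E u v})"
    using finite_nbrs by (intro card_Un_disjoint) auto
  moreover have "card ({u. E u v} - {u \<in> ?Y. E u v}) = card {u. E u v} - card {u \<in> ?Y. E u v}"
    by (intro card_Diff_subset) auto
  moreover have "d \<le> card {u. E u v}" using in_deg v Y_V by blast
  ultimately show ?thesis using deg by linarith
qed

section \<open>The two cases for the size of the intersection\<close>

lemma large_intersection:
  assumes "3 \<le> d" "d \<le> card (X \<inter> Y) + 1"
  shows "7 * d \<le> 2 * card V + 2"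
proof -
  let ?I = "X \<inter> Y"
  have "?I \<noteq> {}" using assms by auto
  then obtain u where u: "u \<in> ?I" by blast
  \<comment> \<open>Dropping \<open>u\<close> from \<open>Y\<close> gives the disjointness that
    \<open>outs_ins_no_arc\<close> demands.\<close>
  define P Q where "P = outs {u}" and "Q = ins (Y - {u})"
  define R where "R = V - (?I \<union> P \<union> Q \<union> {x})"
  have "Y - {u} \<noteq> {}"
  proof
    assume "Y - {u} = {}"
    then have "card Y \<le> card {u}" by (intro card_mono) auto
    then show False using card_Y assms by simp
  qed
  then obtain w where w: "w \<in> Y - {u}" by blast
  have P: "d \<le> card P + 1" unfolding P_def using card_outs[of u "{u}"] u by auto
  have Q: "d \<le> card Q + 1" unfolding Q_def using card_ins[OF w] by auto
  have P_sub: "P \<subseteq> outs X" unfolding P_def outs_def using u by blast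
  have Q_sub: "Q \<subseteq> ins Y" unfolding Q_def ins_def by blast
  have P_Y: "P \<inter> Y = {}" unfolding P_def outs_def using u X_Y_no_arc by blast
  have Q_X: "Q \<inter> X = {}" unfolding Q_def ins_def using X_Y_no_arc by blast
  have P_Q: "P \<inter> Q = {}" using P_sub Q_sub outs_ins_disjoint by blast
  have fin: "finite P" "finite Q" "finite R" "finite ?I"
    unfolding P_def Q_def R_def using finite_V by auto
  have x: "x \<notin> ?I \<union> P \<union> Q" unfolding P_def Q_def using not_x_y by blast
  have "card (?I \<union> P \<union> Q \<union> {x}) = card ?I + card P + card Q + 1"
    using fin P_Y Q_X P_Q x by (subst card_Un_disjoint; auto)+
  moreover have "?I \<union> P \<union> Q \<union> {x} \<subseteq> V"
    unfolding P_def Q_def using X_V outs_V ins_V x_V by blast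
  ultimately have R: "card R + (card ?I + card P + card Q + 1) = card V"
    unfolding R_def using finite_V fin
    by (metis card_Diff_subset card_mono finite_subset le_add_diff_inverse2)
  have no_arc: "\<not> E p q" if "p \<in> P" "q \<in> Q" for p q
    using outs_ins_no_arc[of "{u}" "Y - {u}" p q] that u unfolding P_def Q_def by blast
  \<comment> \<open>Every vertex of \<open>Q\<close> may have in-neighbours in \<open>R\<close>, so
    \<open>Q\<close> serves both as the set counted and as its boundary part. The vertex
    \<open>y\<close> belongs to \<open>R\<close>.\<close>
  have "2 * card Q * d + card Q \<le> card Q * card Q + 2 * card Q * card R"
  proof (rule in_degree_count[where E = E])
    show "d \<le> card {u. E u v}" if "v \<in> Q" for v
      using that in_deg ins_V unfolding Q_def by blast
    show "w \<in> Q \<union> R" if "v \<in> Q" "E w v" for w v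
      using that no_arc ins_in_nbrs Q_sub E_V unfolding R_def by blast
  qed (use fin asym in auto)
  then have "card Q * (2 * d + 1) \<le> card Q * (card Q + 2 * card R)"
    by (simp add: algebra_simps)
  moreover have "card Q > 0" using Q assms by simp
  ultimately have "2 * d + 1 \<le> card Q + 2 * card R" by (simp only: mult_le_cancel1)
  \<comment> \<open>After eliminating \<open>R\<close>, the sizes of \<open>?I\<close>,
    \<open>P\<close> and \<open>Q\<close>, each at least d - 1, enter with coefficients 2, 2 and
    1.\<close>
  then show ?thesis using R P Q assms by linarith
qed

lemma small_intersection:
  assumes "card (X \<inter> Y) + 2 \<le> d"
  shows "7 * d \<le> 2 * card V + 2"
proof (rule ccontr)
  assume "\<not> ?thesis"
  then have deg: "2 * card V + 3 \<le> 7 * d" by simp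
  let ?I = "X \<inter> Y" and ?X = "X - Y" and ?Y = "Y - X"
  \<comment> \<open>Restricting only one side to \<open>X - Y\<close> already makes it disjoint from
    \<open>Y\<close>; the full \<open>ins Y\<close> keeps all in-neighbours of \<open>?Y\<close>
    inside \<open>T\<close>.\<close>
  define S T where "S = ?X \<union> outs ?X" and "T = ?Y \<union> ins Y"
  define Q where "Q = T - ?Y"
  define R where "R = V - (T \<union> S \<union> ?I \<union> {x})"
  have cX: "card ?X + card ?I = card X"
    using card_Diff_subset_Int[of X Y] card_mono[of X ?I] by simp
  have cY: "card ?Y + card ?I = card Y"
    using card_Diff_subset_Int[of Y X] card_mono[of Y ?I] by (simp add: Int_commute)
  have "card ?X \<noteq> 0" using cX card_X assms by linarith
  then have "?X \<noteq> {}" by (metis card.empty)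
  then have S: "2 * d + card ?X + 1 \<le> 2 * card S" unfolding S_def by (rule card_X_outs)
  have "card ?Y \<noteq> 0" using cY card_Y assms by linarith
  then have "?Y \<noteq> {}" by (metis card.empty)
  then have T: "2 * d + card ?Y + 1 \<le> 2 * card T" unfolding T_def by (rule card_Y_ins)
  have outs_Y: "outs ?X \<inter> Y = {}" unfolding outs_def using X_Y_no_arc by blast
  have ins_X: "ins Y \<inter> X = {}" unfolding ins_def using X_Y_no_arc by blast
  have "outs ?X \<subseteq> outs X" unfolding outs_def by blast
  then have outs_ins: "outs ?X \<inter> ins Y = {}" using outs_ins_disjoint by blast
  have TS: "T \<inter> S = {}" unfolding T_def S_def using outs_Y ins_X outs_ins by blast
  have TSI: "(T \<union> S) \<inter> ?I = {}" unfolding T_def S_def using outs_Y ins_X by blast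
  have x: "x \<notin> T \<union> S \<union> ?I" unfolding T_def S_def using not_x_y by blast
  have fin: "finite T" "finite S" "finite ?I" "finite R"
    unfolding T_def S_def R_def using finite_V by auto
  have "card (T \<union> S \<union> ?I \<union> {x}) = card T + card S + card ?I + 1"
    using fin TS TSI x by (subst card_Un_disjoint; auto)+
  moreover have "T \<union> S \<union> ?I \<union> {x} \<subseteq> V"
    unfolding T_def S_def using X_V Y_V outs_V ins_V x_V by blast
  ultimately have R: "card R + (card T + card S + card ?I + 1) = card V"
    unfolding R_def using finite_V fin
    by (metis card_Diff_subset card_mono finite_subset le_add_diff_inverse2)
  have Q: "card Q + card ?Y = card T"
  proof -
    have "?Y \<subseteq> T" unfolding T_def by blast
    then show ?thesis unfolding Q_def using fin
      by (simp add: card_Diff_subset card_mono)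
  qed
  have T_V: "T \<subseteq> V" unfolding T_def using Y_V ins_V by blast
  have Q_ins: "Q \<subseteq> ins Y" unfolding Q_def T_def by blast
  have "2 * card T * d + card T \<le> card T * card T + 2 * card Q * card R"
  proof (rule in_degree_count[where E = E])
    show "d \<le> card {u. E u v}" if "v \<in> T" for v
      using that in_deg T_V by blast
    show "u \<in> T" if "v \<in> T - Q" "E u v" for u v
      using that Y_in_nbrs unfolding Q_def T_def by blast
    show "u \<in> T \<union> R" if "v \<in> Q" "E u v" for u v
    proof -
      have "u \<notin> outs ?X"
        using outs_ins_no_arc[of ?X Y u v] that Q_ins by blast
      then show ?thesis
        using that ins_in_nbrs Q_ins E_V unfolding R_def S_def by blast
    qed
    show "Q \<subseteq> T" unfolding Q_def by blast
  qed (use fin asym in auto)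
  then have "int (2 * card T * d + card T) \<le> int (card T * card T + 2 * card Q * card R)"
    by (simp only: of_nat_le_iff)
  \<comment> \<open>m is a common lower bound for the sizes of \<open>?X\<close> and
    \<open>?Y\<close>; integers make the subtractions below genuine.\<close>
  moreover define m t where "m = int d - 1 - int (card ?I)" and "t = int (card T)"
  ultimately have count: "2 * t * int d + t \<le> t * t + 2 * int (card Q) * int (card R)"
    by simp
  have m: "1 \<le> m" "m \<le> int d - 1" "m \<le> int (card ?X)" "m \<le> int (card ?Y)"
    unfolding m_def using assms cX cY card_X card_Y by linarith+
  have q: "int (card Q) \<le> t - m" using Q m unfolding t_def by linarith
  \<comment> \<open>\<open>R\<close> is what \<open>T\<close>, \<open>S\<close>, \<open>?I\<close>
    and \<open>x\<close> leave of \<open>V\<close>. Insert the bound on \<open>S\<close>, the size d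
    - 1 - m of \<open>?I\<close>, and the negated goal \<open>deg\<close>.\<close>
  have r: "2 * int (card R) \<le> 3 * int d + m - 4 - 2 * t"
    using R S m deg unfolding t_def m_def by linarith
  have "int (card Q) * (2 * int (card R)) \<le> (t - m) * (3 * int d + m - 4 - 2 * t)"
    using q r by (intro mult_mono) auto
  then have "2 * t * int d + t \<le> t * t + (t - m) * (3 * int d + m - 4 - 2 * t)"
    using count by simp
  moreover have "2 * int d + m + 1 \<le> 2 * t" using T m unfolding t_def by linarith
  ultimately show False using degree_inequality_contradiction m by blast
qed

lemma degree_bound:
  assumes "3 \<le> d"
  shows "7 * d \<le> 2 * card V + 2"
  using large_intersection small_intersection assms by linarith

end

section \<open>Transfer to arc walks in digraphs\<close>

context oriented_graph
begin

lemma out_degree_eq_card: "out_degree G v = card {u. v \<rightarrow> u}"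
proof -
  have "{u. v \<rightarrow> u} = head G ` out_arcs G v"
    by (auto simp: arcs_ends_conv)
  moreover have "inj_on (head G) (out_arcs G v)"
    by (rule inj_onI) (auto intro!: no_multi_arcs simp: arc_to_ends_def)
  ultimately show ?thesis by (simp add: out_degree_def card_image)
qed

lemma in_degree_eq_card: "in_degree G v = card {u. u \<rightarrow> v}"
proof -
  have "{u. u \<rightarrow> v} = tail G ` in_arcs G v"
    by (auto simp: arcs_ends_conv)
  moreover have "inj_on (tail G) (in_arcs G v)"
    by (rule inj_onI) (auto intro!: no_multi_arcs simp: arc_to_ends_def)
  ultimately show ?thesis by (simp add: in_degree_def card_image)
qed

lemma min_semidegree_le:
  assumes "v \<in> verts G"
  shows "min_semidegree G \<le> out_degree G v" "min_semidegree G \<le> in_degree G v"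
proof -
  have "min_semidegree G \<le> min (out_degree G v) (in_degree G v)"
    unfolding min_semidegree_def using assms by (intro Min_le) auto
  then show "min_semidegree G \<le> out_degree G v" "min_semidegree G \<le> in_degree G v" by auto
qed

text \<open>The vertex list is part of the conclusion so that the induction step can see that the
  new first vertex avoids the rest of the path.\<close>

lemma ex_apath_of_vertices:
  assumes "successively (\<lambda>u v. u \<rightarrow> v) (u # vs)" "distinct (u # vs)" "u \<in> verts G"
  shows "\<exists>p. apath u p (last (u # vs)) \<and> awalk_verts u p = u # vs"
  using assms
proof (induction vs arbitrary: u)
  case Nil
  then show ?case by (intro exI[of _ "[]"]) (simp add: apath_Nil_iff)
next
  case (Cons v vs)
  from Cons.prems obtain e where e: "e \<in> arcs G" "tail G e = u" "head G e = v"
    by (auto simp: arcs_ends_conv)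
  have "v \<in> verts G" using e by auto
  with Cons obtain p where p: "apath v p (last (v # vs))" "awalk_verts v p = v # vs"
    by auto
  then have "apath u (e # p) (last (u # v # vs)) \<and> awalk_verts u (e # p) = u # v # vs"
    using e Cons.prems by (auto simp: apath_Cons_iff)
  then show ?case by blast
qed

lemma ex_apath_length:
  assumes "successively (\<lambda>u v. u \<rightarrow> v) (u # vs)" "distinct (u # vs)" "u \<in> verts G"
  shows "\<exists>p. apath u p (last (u # vs)) \<and> length p = length vs"
  using ex_apath_of_vertices[OF assms]
  by (metis length_Cons length_awalk_verts nat.inject)

theorem ex_short_apath:
  assumes "x \<in> verts G" "y \<in> verts G" "x \<noteq> y"
    and "3 \<le> min_semidegree G" "2 * card (verts G) + 3 \<le> 7 * min_semidegree G"
  shows "\<exists>p. apath x p y \<and> length p \<in> {3, 4, 5}"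
proof (rule ccontr)
  assume none: "\<not> ?thesis"
  \<comment> \<open>\<open>vs\<close> lists the interior vertices, one fewer than the arcs.\<close>
  have no_path: "\<not> (successively (\<lambda>u v. u \<rightarrow> v) (x # vs @ [y]) \<and> distinct (x # vs @ [y]))"
    if "length vs \<in> {2, 3, 4}" for vs
  proof
    assume "successively (\<lambda>u v. u \<rightarrow> v) (x # vs @ [y]) \<and> distinct (x # vs @ [y])"
    then obtain p where "apath x p (last (x # vs @ [y]))" "length p = length (vs @ [y])"
      using ex_apath_length[of x "vs @ [y]"] assms(1) by blast
    then show False using none that by auto
  qed
  interpret no_short_path "verts G" "\<lambda>u v. u \<rightarrow> v" "min_semidegree G" x y
  proof
    show "min_semidegree G \<le> card {u. v \<rightarrow> u}" "min_semidegree G \<le> card {u. u \<rightarrow> v}"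
      if "v \<in> verts G" for v
      using min_semidegree_le[OF that] by (simp_all add: out_degree_eq_card in_degree_eq_card)
    show "\<not> distinct [x, a, b, y]" if "x \<rightarrow> a" "a \<rightarrow> b" "b \<rightarrow> y" for a b
      using no_path[of "[a, b]"] that by simp
    show "\<not> distinct [x, a, b, c, y]" if "x \<rightarrow> a" "a \<rightarrow> b" "b \<rightarrow> c" "c \<rightarrow> y" for a b c
      using no_path[of "[a, b, c]"] that by simp
    show "\<not> distinct [x, a, b, c, e, y]" if "x \<rightarrow> a" "a \<rightarrow> b" "b \<rightarrow> c" "c \<rightarrow> e" "e \<rightarrow> y" for a b c e
      using no_path[of "[a, b, c, e]"] that by simp
  qed (use assms no_2cycle adj_in_verts in auto)
  show False using degree_bound assms by simp
qed

end

theorem corollary2p3: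
  fixes H :: "('a, 'b) pre_digraph" and C N :: nat
  assumes "C \<ge> 1"
    and "oriented_graph H"
    and "N = card (verts H)"
    and "int N \<ge> 21 * int C - 12"
    and "real (min_semidegree H) \<ge> real N / 3 - real C + 1"
  shows "\<forall>x \<in> verts H. \<forall>y \<in> verts H. x \<noteq> y \<longrightarrow>
           (\<exists>p. pre_digraph.apath H x p y \<and> length p \<in> {3, 4, 5})"
proof -
  interpret oriented_graph H by fact
  have "real N + 3 \<le> real (3 * min_semidegree H + 3 * C)"
    using assms(5) by simp
  then have "N + 3 \<le> 3 * min_semidegree H + 3 * C"
    by linarith
  \<comment> \<open>Multiplying the previous bound by 7/3 gives the first inequality exactly when N
    is at least 21C - 12; the second follows from 3d \<ge> 18C - 9 \<ge> 9.\<close>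
  then have "2 * N + 3 \<le> 7 * min_semidegree H" "3 \<le> min_semidegree H"
    using assms(1,4) by linarith+
  then show ?thesis using ex_short_apath assms(3) by blast
qed

end
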